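(* Let $V$ be a $d$-dimensional vector space over a field $K$, where $d>1$. Let $\Phi$ be a group (possibly trivial) of automorphisms of $K$, and let $G$ be a group with $\mathrm{SL}(V) \le G\le \mathrm{GL}(V)$. If $G\cdot \Phi$ is join-coherent in its action on $V\setminus\{0\}$ then $K=\mathbf{F}_2$ and $d=2$.
   Context: Here $d$ is a finite dimension. For a group $H$ acting on a set $\Omega$ and $h\in H$, $\pi(h)$ denotes the partition of $\Omega$ into the orbits of $h$, and $\pi(H)=\{\pi(h)\mid h\in H\}$. Partitions are ordered by refinement, and $\vee$ denotes the supremum (join) of two partitions. $H$ is join-coherent if $\pi(H)$ is closed under $\vee$. The group $\Phi$ acts on $V\cong K^d$ coordinatewise with respect to a fixed basis, and $G\cdot\Phi$ denotes the group of semilinear transformations of $V$ that is the extension of $G$ by $\Phi$ (so $\Phi$ is understood to normalize $G$), acting on the non-zero vectors of $V$. *)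

theory Defs
  imports "HOL-Analysis.Analysis" "HOL-Algebra.Group_Action" "HOL-Algebra.Generated_Groups"
    "HOL-Library.Disjoint_Sets"
begin

section \<open>Join-coherence of a group action\<close>

definition orbit_partition ::
    "('g, 'm) monoid_scheme \<Rightarrow> 'x set \<Rightarrow> ('g \<Rightarrow> 'x \<Rightarrow> 'x) \<Rightarrow> 'g \<Rightarrow> 'x set set" where
  "orbit_partition H \<Omega> act h = orbits (H\<lparr>carrier := generate H {h}\<rparr>) \<Omega> act"

definition partition_order :: "'x set \<Rightarrow> 'x set set gorder" where
  "partition_order \<Omega> = \<lparr>carrier = {P. partition_on \<Omega> P}, eq = (=), le = refines \<Omega>\<rparr>"

definition join_coherent ::
    "('g, 'm) monoid_scheme \<Rightarrow> 'x set \<Rightarrow> ('g \<Rightarrow> 'x \<Rightarrow> 'x) \<Rightarrow> bool" where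
  "join_coherent H \<Omega> act \<longleftrightarrow>
     (let \<pi>H = orbit_partition H \<Omega> act ` carrier H in
      \<forall>P\<in>\<pi>H. \<forall>Q\<in>\<pi>H. \<exists>R\<in>\<pi>H. is_lub (partition_order \<Omega>) R {P, Q})"


section \<open>Linear and semilinear groups\<close>

text \<open>
  Transformation groups of a space are subgroups of the symmetric group
  \<^term>\<open>BijGroup UNIV\<close> of that space, whose multiplication is composition.
\<close>

definition GL :: "('a::field ^ 'n \<Rightarrow> 'a ^ 'n) set" where
  "GL = {f. Vector_Spaces.linear (*s) (*s) f \<and> bij f}"

definition SL :: "('a::field ^ 'n \<Rightarrow> 'a ^ 'n) set" where
  "SL = {f \<in> GL. det (matrix f) = 1}"

text \<open>Preservation of 0 and 1 follows from the conditions listed.\<close>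

definition field_aut :: "('a::field \<Rightarrow> 'a) set" where
  "field_aut = {\<phi>. bij \<phi> \<and> (\<forall>x y. \<phi> (x + y) = \<phi> x + \<phi> y) \<and> (\<forall>x y. \<phi> (x * y) = \<phi> x * \<phi> y)}"

definition coordinatewise :: "('a \<Rightarrow> 'a) \<Rightarrow> 'a ^ 'n \<Rightarrow> 'a ^ 'n" where
  "coordinatewise \<phi> v = (\<chi> i. \<phi> (v $ i))"

definition normalizes :: "('a \<Rightarrow> 'a) set \<Rightarrow> ('a ^ 'n \<Rightarrow> 'a ^ 'n) set \<Rightarrow> bool" where
  "normalizes \<Phi> G \<longleftrightarrow>
     (\<forall>\<phi>\<in>\<Phi>. (\<lambda>g. coordinatewise \<phi> \<circ> g) ` G = (\<lambda>g. g \<circ> coordinatewise \<phi>) ` G)"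

definition semilinear_group ::
    "('a ^ 'n \<Rightarrow> 'a ^ 'n) set \<Rightarrow> ('a \<Rightarrow> 'a) set \<Rightarrow> ('a ^ 'n \<Rightarrow> 'a ^ 'n) monoid" where
  "semilinear_group G \<Phi> =
     BijGroup UNIV\<lparr>carrier := {g \<circ> coordinatewise \<phi> | g \<phi>. g \<in> G \<and> \<phi> \<in> \<Phi>}\<rparr>"

text \<open>
  \<^term>\<open>BijGroup (UNIV - {0})\<close> consists of functions that are \<^term>\<open>undefined\<close> at 0, hence
  the restriction.
\<close>

definition nonzero_action :: "('a::zero ^ 'n \<Rightarrow> 'a ^ 'n) \<Rightarrow> 'a ^ 'n \<Rightarrow> 'a ^ 'n" where
  "nonzero_action h = restrict h (UNIV - {0})"

end

theory Submission
  imports Defs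
begin

text \<open>
  If the orbits of \<open>r\<close> are the joins of the orbits of \<open>h\<close> and \<open>k\<close>, then the sets invariant under
  \<open>r\<close> are those invariant under both \<open>h\<close> and \<open>k\<close>. This is used for three pairs \<open>h, k\<close>.
  Two shears along the hyperplane \<open>v\<^sub>j = 0\<close> force \<open>r\<close> to fix this hyperplane pointwise and to
  translate the basis vector \<open>e\<^sub>j\<close>, so that the two displacements lie in a cyclic group; hence the
  dimension is 2 and every scalar is a quotient of integers, which makes the field automorphisms
  trivial. Two dilations \<open>diag(a, 1)\<close> and \<open>diag(1, a)\<close> force \<open>r = diag(x, y)\<close>, where the powers of
  \<open>(x, y)\<close> include both \<open>(a, 1)\<close> and \<open>(1, a)\<close> and \<open>y\<close> is a power of \<open>a\<close>; hence \<open>a = 1\<close>, and the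
  group is SL. Finally let \<open>h, k\<close> be an upper and a lower shear. The quadratic form
  \<open>v \<mapsto> det(v, r v)\<close> is constant on the orbits of \<open>r\<close>, as \<open>det r = 1\<close>, hence invariant under both
  shears; this is only possible if \<open>2 = 0\<close>, and then every quotient of integers is 0 or 1.
\<close>

section \<open>Invariant sets of joins\<close>

context group_action
begin

text \<open>The hypothesis is an equivalence so that it covers inverses as well: it is applied at
  the point that \<open>r\<close> carries to \<open>v\<close>.\<close>

lemma generate_preserves_invariant_set:
  assumes r: "r \<in> carrier G" and S: "\<And>w. w \<in> E \<Longrightarrow> \<phi> r w \<in> S \<longleftrightarrow> w \<in> S"
    and g: "g \<in> generate G {r}" and v: "v \<in> E"
  shows "\<phi> g v \<in> S \<longleftrightarrow> v \<in> S"
  using g v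
proof (induction arbitrary: v rule: generate.induct)
  case one
  then show ?case using id_eq_one by (metis restrict_apply')
next
  case (incl h)
  then show ?case using S by simp
next
  case (inv h)
  interpret group G using group_hom group_hom.axioms(1) by auto
  have w: "\<phi> (inv r) v \<in> E" using element_image inv.prems r by blast
  have "\<phi> r (\<phi> (inv r) v) = v"
    using orbit_sym_aux[of "inv r" v] r inv.prems by simp
  then show ?case using S[OF w] inv by simp
next
  case (eng h1 h2)
  interpret group G using group_hom group_hom.axioms(1) by auto
  have "generate G {r} \<subseteq> carrier G" using generate_incl r by simp
  then have h: "h1 \<in> carrier G" "h2 \<in> carrier G" using eng by auto
  then show ?case
    using eng composition_rule[OF eng.prems h] element_image[OF h(2) eng.prems] by simp
qed

lemma partition_on_orbit_partition:
  assumes "r \<in> carrier G"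
  shows "partition_on E (orbit_partition G E \<phi> r)"
proof -
  interpret group G using group_hom group_hom.axioms(1) by auto
  let ?G = "G\<lparr>carrier := generate G {r}\<rparr>"
  interpret sub: group_action ?G E \<phi>
    using induced_action generate_is_subgroup assms by simp
  show ?thesis
    unfolding orbit_partition_def
  proof (rule partition_onI)
    show "\<Union> (orbits ?G E \<phi>) = E" by (rule sub.orbits_coverture)
    show "disjnt p q" if "p \<in> orbits ?G E \<phi>" "q \<in> orbits ?G E \<phi>" "p \<noteq> q" for p q
      using sub.disjoint_union that by (auto simp: disjnt_def)
    show "{} \<notin> orbits ?G E \<phi>"
      using sub.orbit_refl by (auto simp: orbits_def)
  qed
qed

text \<open>Invariance of \<open>S\<close> becomes a refinement relation with the partition into
  \<open>S\<close> and its complement, so that the universal property of a supremum can be applied.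
  The empty block is removed because \<open>S\<close> or its complement may be empty in
  \<open>E\<close>.\<close>

lemma refines_two_blocks_iff:
  assumes r: "r \<in> carrier G"
  shows "refines E (orbit_partition G E \<phi> r) ({E \<inter> S, E - S} - {{}})
    \<longleftrightarrow> (\<forall>v\<in>E. \<phi> r v \<in> S \<longleftrightarrow> v \<in> S)" (is "refines E ?P ?Q \<longleftrightarrow> ?I")
proof
  assume R: "refines E ?P ?Q"
  show ?I
  proof
    fix v assume v: "v \<in> E"
    let ?O = "{\<phi> g v |g. g \<in> generate G {r}}"
    have "?O \<in> ?P"
      using v by (auto simp: orbit_partition_def orbits_def orbit_def)
    then obtain X where "X \<in> {E \<inter> S, E - S}" "?O \<subseteq> X"
      using R unfolding refines_def by blast
    moreover have "\<phi> r v \<in> ?O" by (auto intro: generate.incl)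
    moreover have "v \<in> ?O"
      using v id_eq_one generate.one[of G "{r}"] by (smt (verit) mem_Collect_eq restrict_apply')
    ultimately show "\<phi> r v \<in> S \<longleftrightarrow> v \<in> S" by blast
  qed
next
  interpret group G using group_hom group_hom.axioms(1) by auto
  assume I: ?I
  have gen: "generate G {r} \<subseteq> carrier G" using generate_incl r by simp
  have Q: "partition_on E ?Q"
    by (rule partition_onI) (auto simp: disjnt_def)
  have "\<exists>Y\<in>?Q. X \<subseteq> Y" if X_in: "X \<in> ?P" for X
  proof -
    obtain v where v: "v \<in> E" and X: "X = {\<phi> g v |g. g \<in> generate G {r}}"
      using X_in by (auto simp: orbit_partition_def orbits_def orbit_def)
    have "X \<subseteq> E" using X v gen element_image by auto
    moreover have "x \<in> S \<longleftrightarrow> v \<in> S" if "x \<in> X" for x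
      using that X generate_preserves_invariant_set[OF r _ _ v] I by auto
    ultimately have "X \<subseteq> (if v \<in> S then E \<inter> S else E - S)" by auto
    moreover have "(if v \<in> S then E \<inter> S else E - S) \<in> ?Q" using v by auto
    ultimately show ?thesis by blast
  qed
  then show "refines E ?P ?Q"
    using Q partition_on_orbit_partition[OF r] by (simp add: refines_def)
qed

text \<open>A partition is determined by the sets that are unions of its parts, and those of an orbit
  partition are the invariant sets.\<close>

lemma join_coherent_invariant_sets:
  assumes "join_coherent G E \<phi>" and h: "h \<in> carrier G" and k: "k \<in> carrier G"
  obtains r where "r \<in> carrier G"
    and "\<And>S. (\<forall>v\<in>E. \<phi> r v \<in> S \<longleftrightarrow> v \<in> S) \<longleftrightarrow>
      (\<forall>v\<in>E. \<phi> h v \<in> S \<longleftrightarrow> v \<in> S) \<and> (\<forall>v\<in>E. \<phi> k v \<in> S \<longleftrightarrow> v \<in> S)"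
proof -
  let ?\<pi> = "orbit_partition G E \<phi>"
  obtain r where r: "r \<in> carrier G" and lub: "is_lub (partition_order E) (?\<pi> r) {?\<pi> h, ?\<pi> k}"
    using assms unfolding join_coherent_def Let_def by blast
  have "?\<pi> r \<in> Upper (partition_order E) {?\<pi> h, ?\<pi> k}"
    and least: "\<And>P. P \<in> Upper (partition_order E) {?\<pi> h, ?\<pi> k} \<Longrightarrow> refines E (?\<pi> r) P"
    using lub by (auto simp: least_def partition_order_def)
  then have upper: "refines E (?\<pi> h) (?\<pi> r)" "refines E (?\<pi> k) (?\<pi> r)"
    using h k partition_on_orbit_partition by (auto simp: Upper_def partition_order_def)
  \<comment> \<open>This is the universal property of the supremum; it is used below for the
    two-block partitions.\<close>
  have "refines E (?\<pi> r) P \<longleftrightarrow> refines E (?\<pi> h) P \<and> refines E (?\<pi> k) P" for P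
  proof
    assume "refines E (?\<pi> h) P \<and> refines E (?\<pi> k) P"
    then have "P \<in> Upper (partition_order E) {?\<pi> h, ?\<pi> k}"
      by (auto simp: Upper_def partition_order_def refines_def)
    then show "refines E (?\<pi> r) P" by (rule least)
  qed (use upper refines_trans in blast)
  then show thesis
    using that[OF r] refines_two_blocks_iff h k r by (metis (no_types, lifting))
qed

end

section \<open>The group of semilinear transformations\<close>

lemma carrier_BijGroup_UNIV: "carrier (BijGroup UNIV) = {f. bij f}"
  by (auto simp: BijGroup_def Bij_def)

lemma mult_BijGroup_UNIV: "bij f \<Longrightarrow> bij g \<Longrightarrow> f \<otimes>\<^bsub>BijGroup UNIV\<^esub> g = f \<circ> g"
  by (auto simp: BijGroup_def Bij_def compose_def)

lemma one_BijGroup_UNIV: "\<one>\<^bsub>BijGroup UNIV\<^esub> = id"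
  by (auto simp: BijGroup_def)

lemma inv_BijGroup_UNIV: "bij f \<Longrightarrow> inv\<^bsub>BijGroup UNIV\<^esub> f = inv_into UNIV f"
  by (simp add: inv_BijGroup Bij_def fun_eq_iff)

text \<open>Subgroup conditions can thus be proved and used with plain composition and
  \<open>inv_into\<close>.\<close>

lemma subgroup_BijGroup_UNIV_iff:
  "subgroup H (BijGroup UNIV) \<longleftrightarrow>
    (\<forall>f\<in>H. bij f) \<and> (\<forall>f\<in>H. \<forall>g\<in>H. f \<circ> g \<in> H) \<and> id \<in> H \<and> (\<forall>f\<in>H. inv_into UNIV f \<in> H)"
proof (cases "\<forall>f\<in>H. bij f")
  case True
  then have bij: "f \<in> H \<Longrightarrow> bij f" for f by blast
  show ?thesis
    by (simp add: subgroup_def carrier_BijGroup_UNIV one_BijGroup_UNIV bij mult_BijGroup_UNIV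
        inv_BijGroup_UNIV subset_iff Ball_def cong: imp_cong)
next
  case False
  then show ?thesis by (auto simp: subgroup_def carrier_BijGroup_UNIV)
qed

section \<open>Field automorphisms and their coordinatewise action\<close>

lemma field_aut_0:
  assumes "\<phi> \<in> field_aut" shows "\<phi> (0::'a::field) = 0"
proof -
  have "\<phi> (0 + 0) = \<phi> 0 + \<phi> 0" using assms unfolding field_aut_def by blast
  then have "\<phi> 0 + 0 = \<phi> 0 + \<phi> 0" by (simp only: add_0_left add_0_right)
  then show ?thesis by (simp only: add_left_cancel)
qed

lemma field_aut_1:
  assumes "\<phi> \<in> field_aut" shows "\<phi> (1::'a::field) = 1"
proof -
  have "\<phi> 1 \<noteq> \<phi> 0" using assms by (simp add: field_aut_def bij_def inj_eq)
  moreover have "\<phi> (1 * 1) = \<phi> 1 * \<phi> 1" using assms unfolding field_aut_def by blast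
  ultimately show ?thesis using field_aut_0[OF assms] by simp
qed

lemma field_aut_of_int:
  assumes "\<phi> \<in> field_aut" shows "\<phi> (of_int n :: 'a::field) = of_int n"
proof -
  have add: "\<phi> (x + y) = \<phi> x + \<phi> y" for x y using assms by (simp add: field_aut_def)
  have minus: "\<phi> (- x) = - \<phi> x" for x
    using add[of x "- x"] field_aut_0[OF assms] by (simp add: eq_neg_iff_add_eq_0 add.commute)
  have nat: "\<phi> (of_nat k) = of_nat k" for k
    by (induction k) (simp_all add: add field_aut_0[OF assms] field_aut_1[OF assms])
  show ?thesis by (cases n rule: int_cases2) (simp_all add: nat minus)
qed

lemma coordinatewise_comp: "coordinatewise (\<phi> \<circ> \<psi>) = coordinatewise \<phi> \<circ> coordinatewise \<psi>"
  by (simp add: coordinatewise_def fun_eq_iff vec_eq_iff)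

lemma coordinatewise_id [simp]: "coordinatewise id = id"
  by (simp add: coordinatewise_def fun_eq_iff vec_eq_iff)

lemma bij_coordinatewise:
  assumes "bij \<phi>"
  shows "bij (coordinatewise \<phi> :: 'a ^ 'n \<Rightarrow> 'a ^ 'n)"
    and "inv_into UNIV (coordinatewise \<phi> :: 'a ^ 'n \<Rightarrow> 'a ^ 'n) = coordinatewise (inv_into UNIV \<phi>)"
proof -
  have *: "coordinatewise \<phi> \<circ> coordinatewise (inv_into UNIV \<phi>) = (id :: 'a ^ 'n \<Rightarrow> 'a ^ 'n)"
    "coordinatewise (inv_into UNIV \<phi>) \<circ> coordinatewise \<phi> = (id :: 'a ^ 'n \<Rightarrow> 'a ^ 'n)"
    using surj_iff[THEN iffD1, OF bij_is_surj[OF assms]] inv_o_cancel[OF bij_is_inj[OF assms]]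
    by (simp_all flip: coordinatewise_comp)
  show "bij (coordinatewise \<phi> :: 'a ^ 'n \<Rightarrow> 'a ^ 'n)" using * o_bij by blast
  show "inv_into UNIV (coordinatewise \<phi> :: 'a ^ 'n \<Rightarrow> 'a ^ 'n) = coordinatewise (inv_into UNIV \<phi>)"
    using * by (rule inv_unique_comp)
qed

text \<open>For a bijection \<open>f\<close> the equivalence says that \<open>f\<close> maps
  \<open>S\<close> onto itself; mapping \<open>S\<close> into itself would be weaker when
  \<open>S\<close> is infinite.\<close>

definition preserves :: "('x \<Rightarrow> 'x) \<Rightarrow> 'x set \<Rightarrow> bool" where
  "preserves f S \<longleftrightarrow> (\<forall>v. f v \<in> S \<longleftrightarrow> v \<in> S)"

text \<open>The condition on the dimension enters later, in the form of distinct indices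
  \<open>i\<close> and \<open>j\<close>.\<close>

locale join_coherent_semilinear =
  fixes G :: "('a::field ^ 'n \<Rightarrow> 'a ^ 'n) set"
    and \<Phi> :: "('a \<Rightarrow> 'a) set"
  assumes Phi_subgroup: "subgroup \<Phi> (BijGroup UNIV)" and Phi_aut: "\<Phi> \<subseteq> field_aut"
    and G_subgroup: "subgroup G (BijGroup UNIV)" and SL_subset: "SL \<subseteq> G" and G_subset: "G \<subseteq> GL"
    and normalizes: "normalizes \<Phi> G"
    and coherent: "join_coherent (semilinear_group G \<Phi>) (UNIV - {0}) nonzero_action"
begin

text \<open>As \<Phi> normalizes \<open>G\<close>, a coordinatewise map can be moved to the right
  past an element of \<open>G\<close>, at the cost of changing that element. This brings products
  and inverses back to the required form.\<close>

lemma subgroup_semilinear: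
  "subgroup {g \<circ> coordinatewise \<phi> | g \<phi>. g \<in> G \<and> \<phi> \<in> \<Phi>} (BijGroup UNIV)" (is "subgroup ?C _")
proof -
  note G = G_subgroup[unfolded subgroup_BijGroup_UNIV_iff]
  note Phi = Phi_subgroup[unfolded subgroup_BijGroup_UNIV_iff]
  have swap: "\<exists>g'\<in>G. coordinatewise \<phi> \<circ> g = g' \<circ> coordinatewise \<phi>" if "g \<in> G" "\<phi> \<in> \<Phi>" for g \<phi>
    using normalizes that unfolding normalizes_def by blast
  show ?thesis
    unfolding subgroup_BijGroup_UNIV_iff
  proof (intro conjI ballI)
    show "bij f" if "f \<in> ?C" for f
      using that G Phi bij_coordinatewise(1) by (auto intro!: bij_comp)
    have "id = id \<circ> coordinatewise (id :: 'a \<Rightarrow> 'a)" by simp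
    then show "id \<in> ?C" using G Phi by blast
    show "f1 \<circ> f2 \<in> ?C" if "f1 \<in> ?C" "f2 \<in> ?C" for f1 f2
    proof -
      obtain g1 \<phi>1 g2 \<phi>2 where f: "f1 = g1 \<circ> coordinatewise \<phi>1" "f2 = g2 \<circ> coordinatewise \<phi>2"
        and mem: "g1 \<in> G" "g2 \<in> G" "\<phi>1 \<in> \<Phi>" "\<phi>2 \<in> \<Phi>" using \<open>f1 \<in> ?C\<close> \<open>f2 \<in> ?C\<close> by blast
      obtain g' where g': "g' \<in> G" "coordinatewise \<phi>1 \<circ> g2 = g' \<circ> coordinatewise \<phi>1"
        using swap mem by blast
      have "f1 \<circ> f2 = g1 \<circ> (coordinatewise \<phi>1 \<circ> g2) \<circ> coordinatewise \<phi>2"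
        by (simp add: f comp_assoc)
      also have "\<dots> = (g1 \<circ> g') \<circ> coordinatewise (\<phi>1 \<circ> \<phi>2)"
        by (simp add: g' comp_assoc coordinatewise_comp)
      finally show ?thesis using G Phi mem g' by blast
    qed
    show "inv_into UNIV f \<in> ?C" if "f \<in> ?C" for f
    proof -
      obtain g \<phi> where f: "f = g \<circ> coordinatewise \<phi>" and mem: "g \<in> G" "\<phi> \<in> \<Phi>"
        using \<open>f \<in> ?C\<close> by blast
      have "inv_into UNIV g \<in> G" "inv_into UNIV \<phi> \<in> \<Phi>" using mem G Phi by simp_all
      from swap[OF this] obtain g' where g': "g' \<in> G"
        "coordinatewise (inv_into UNIV \<phi>) \<circ> inv_into UNIV g = g' \<circ> coordinatewise (inv_into UNIV \<phi>)"
        by blast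
      have "inv_into UNIV f = inv_into UNIV (coordinatewise \<phi>) \<circ> inv_into UNIV g"
        unfolding f using mem G Phi bij_coordinatewise(1) by (intro o_inv_distrib) blast+
      also have "\<dots> = g' \<circ> coordinatewise (inv_into UNIV \<phi>)"
        using g' mem Phi by (simp add: bij_coordinatewise(2))
      finally show ?thesis using g' Phi mem by blast
    qed
  qed
qed

lemma G_linear:
  assumes "g \<in> G"
  shows "Vector_Spaces.linear (*s) (*s) g" "bij g" "g (v + w) = g v + g w" "g (c *s v) = c *s g v"
    "g 0 = 0"
proof -
  show lin: "Vector_Spaces.linear (*s) (*s) g" and "bij g"
    using assms G_subset by (auto simp: GL_def)
  interpret Vector_Spaces.linear "(*s)" "(*s)" g by (rule lin)
  show "g (v + w) = g v + g w" "g (c *s v) = c *s g v" "g 0 = 0"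
    by (simp_all add: add scale)
qed

lemma semilinear_0:
  assumes "g \<in> G" "\<phi> \<in> \<Phi>"
  shows "g (coordinatewise \<phi> 0) = 0"
proof -
  have "coordinatewise \<phi> 0 = (0 :: 'a ^ 'n)"
    using assms Phi_aut field_aut_0 by (auto simp: coordinatewise_def vec_eq_iff)
  then show ?thesis using G_linear(5) assms by simp
qed

lemma carrier_semilinear_group:
  "carrier (semilinear_group G \<Phi>) = {g \<circ> coordinatewise \<phi> | g \<phi>. g \<in> G \<and> \<phi> \<in> \<Phi>}"
  by (simp add: semilinear_group_def)

text \<open>Semilinear maps are bijective and fix 0, so they permute the nonzero vectors, and
  restricting to these is compatible with composition.\<close>

lemma group_action_nonzero:
  "group_action (semilinear_group G \<Phi>) (UNIV - {0}) nonzero_action"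
proof -
  let ?C = "carrier (semilinear_group G \<Phi>)" and ?E = "UNIV - {0 :: 'a ^ 'n}"
  have sub: "subgroup ?C (BijGroup UNIV)"
    using subgroup_semilinear by (simp add: semilinear_group_def)
  have bij: "bij f" and zero: "f 0 = 0" if "f \<in> ?C" for f
    using that sub semilinear_0
    by (auto simp: subgroup_BijGroup_UNIV_iff carrier_semilinear_group)
  have group: "group (semilinear_group G \<Phi>)"
    using group.subgroup_imp_group[OF group_BijGroup subgroup_semilinear]
    by (simp add: semilinear_group_def)
  have nz: "f v = 0 \<longleftrightarrow> v = 0" if "f \<in> ?C" for f v
    using bij[OF that] zero[OF that] by (metis bij_is_inj injD)
  have Bij: "nonzero_action f \<in> Bij ?E" if "f \<in> ?C" for f
  proof -
    have "bij_betw f (UNIV - {0}) (UNIV - {f 0})"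
      using bij[OF that] by (intro bij_betw_DiffI) auto
    then show ?thesis
      using zero[OF that] by (simp add: Bij_def nonzero_action_def)
  qed
  have "nonzero_action \<in> hom (semilinear_group G \<Phi>) (BijGroup ?E)"
  proof (rule homI)
    show "nonzero_action f \<in> carrier (BijGroup ?E)" if "f \<in> ?C" for f
      using Bij that by (simp add: BijGroup_def)
    show "nonzero_action (f1 \<otimes>\<^bsub>semilinear_group G \<Phi>\<^esub> f2) =
        nonzero_action f1 \<otimes>\<^bsub>BijGroup ?E\<^esub> nonzero_action f2" if f: "f1 \<in> ?C" "f2 \<in> ?C" for f1 f2
    proof -
      have "f1 \<otimes>\<^bsub>semilinear_group G \<Phi>\<^esub> f2 = f1 \<circ> f2"
        using mult_BijGroup_UNIV[of f1 f2] bij f by (simp add: semilinear_group_def)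
      moreover have "nonzero_action f1 \<otimes>\<^bsub>BijGroup ?E\<^esub> nonzero_action f2 =
          compose ?E (nonzero_action f1) (nonzero_action f2)"
        using Bij f by (simp add: BijGroup_def)
      moreover have "nonzero_action (f1 \<circ> f2) =
          compose ?E (nonzero_action f1) (nonzero_action f2)"
        using nz[OF f(2)] by (simp add: nonzero_action_def compose_def restrict_def fun_eq_iff)
      ultimately show ?thesis by simp
    qed
  qed
  then show ?thesis
    using group by (simp add: group_action_def group_hom_def group_hom_axioms_def group_BijGroup)
qed

text \<open>This is the form in which join-coherence is used from here on. All maps involved fix 0,
  so invariance on the nonzero vectors is the same as invariance on the whole space.\<close>

lemma join_preserves:
  assumes h: "h \<in> G" and k: "k \<in> G"
  obtains g \<phi> where "g \<in> G" "\<phi> \<in> \<Phi>"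
    and "\<And>S. preserves (g \<circ> coordinatewise \<phi>) S \<longleftrightarrow> preserves h S \<and> preserves k S"
proof -
  let ?C = "carrier (semilinear_group G \<Phi>)"
  have mem: "f \<in> ?C" if "f \<in> G" for f
  proof -
    have "f = f \<circ> coordinatewise id" by simp
    then show ?thesis
      using that Phi_subgroup unfolding carrier_semilinear_group subgroup_BijGroup_UNIV_iff by blast
  qed
  obtain r where r: "r \<in> ?C" and
    inv: "\<And>S. (\<forall>v\<in>UNIV - {0}. nonzero_action r v \<in> S \<longleftrightarrow> v \<in> S) \<longleftrightarrow>
      (\<forall>v\<in>UNIV - {0}. nonzero_action h v \<in> S \<longleftrightarrow> v \<in> S) \<and>
      (\<forall>v\<in>UNIV - {0}. nonzero_action k v \<in> S \<longleftrightarrow> v \<in> S)"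
    using group_action.join_coherent_invariant_sets[OF group_action_nonzero coherent mem[OF h] mem[OF k]]
    by blast
  have *: "(\<forall>v\<in>UNIV - {0}. nonzero_action f v \<in> S \<longleftrightarrow> v \<in> S) \<longleftrightarrow> (\<forall>v. f v \<in> S \<longleftrightarrow> v \<in> S)"
    if "f 0 = 0" for f :: "'a ^ 'n \<Rightarrow> 'a ^ 'n" and S
    using that by (simp add: nonzero_action_def Ball_def) metis
  obtain g \<phi> where g: "g \<in> G" "\<phi> \<in> \<Phi>" "r = g \<circ> coordinatewise \<phi>"
    using r by (auto simp: carrier_semilinear_group)
  have "preserves r S \<longleftrightarrow> preserves h S \<and> preserves k S" for S
    using inv[of S] *[of h S] *[of k S] *[of r S] G_linear(5) h k semilinear_0 g
    by (simp add: preserves_def)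
  then show thesis using that[OF g(1,2)] g(3) by simp
qed

end

section \<open>Shears and dilations\<close>

definition shear :: "'n::finite \<Rightarrow> 'n \<Rightarrow> 'a::field \<Rightarrow> 'a ^ 'n \<Rightarrow> 'a ^ 'n" where
  "shear i j c v = v + axis i (c * v $ j)"

definition dilation :: "'n::finite \<Rightarrow> 'a::field \<Rightarrow> 'a ^ 'n \<Rightarrow> 'a ^ 'n" where
  "dilation i a v = (\<chi> l. if l = i then a * v $ l else v $ l)"

lemma mult_matrix_in_GL:
  fixes A :: "'a::field ^ 'n ^ 'n"
  assumes "det A \<noteq> 0" shows "(*v) A \<in> GL"
  using assms by (simp add: GL_def invertible_det_nz flip: invertible_eq_bij)

lemma shear_in_SL:
  fixes i j :: "'n::finite"
  assumes "i \<noteq> j"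
  shows "shear i j (c :: 'a::field) \<in> SL"
proof -
  \<comment> \<open>The matrix is the result of a row operation on the identity, which leaves the
    determinant at 1.\<close>
  let ?A = "(\<chi> k. if k = i then row i (mat 1) + c *s row j (mat 1) else row k (mat 1)) :: 'a ^ 'n ^ 'n"
  have det: "det ?A = 1" using det_row_operation[OF assms, of "mat 1" c] by simp
  have "shear i j c v $ k = (?A *v v) $ k" for v k
    by (cases "k = i") (simp_all add: shear_def axis_def matrix_vector_mult_def row_def mat_def
        distrib_right sum.distrib mult.assoc mult_delta_left mult_delta_right)
  then have "shear i j c = (*v) ?A" by (simp add: fun_eq_iff vec_eq_iff)
  then show ?thesis using det mult_matrix_in_GL[of ?A] by (simp add: SL_def)
qed

lemma dilation_in_GL:
  fixes a :: "'a::field" and i :: "'n::finite"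
  shows "a \<noteq> 0 \<Longrightarrow> dilation i a \<in> (GL :: ('a ^ 'n \<Rightarrow> 'a ^ 'n) set)"
    and "det (matrix (dilation i a :: 'a ^ 'n \<Rightarrow> 'a ^ 'n)) = a"
proof -
  let ?A = "(\<chi> k l. if k = l then if k = i then a else 1 else 0) :: 'a ^ 'n ^ 'n"
  have "det ?A = (\<Prod>k\<in>UNIV. if k = i then a else 1)"
    by (subst det_diagonal) auto
  then have det: "det ?A = a" by simp
  have "dilation i a v $ k = (?A *v v) $ k" for v k
    by (cases "k = i") (simp_all add: dilation_def matrix_vector_mult_def mult_delta_left)
  then have "dilation i a = (*v) ?A" by (simp add: fun_eq_iff vec_eq_iff)
  then show "a \<noteq> 0 \<Longrightarrow> dilation i a \<in> (GL :: ('a ^ 'n \<Rightarrow> 'a ^ 'n) set)"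
    and "det (matrix (dilation i a :: 'a ^ 'n \<Rightarrow> 'a ^ 'n)) = a"
    using det mult_matrix_in_GL[of ?A] by simp_all
qed

lemma axis_scale: "c *s axis i b = axis i (c * b :: 'a::field)"
  by (simp add: vec_eq_iff axis_def)

text \<open>The index type is any type with two elements; the only permutations are the identity and
  the swap of \<open>i\<close> and \<open>j\<close>.\<close>

lemma det_UNIV_doubleton:
  fixes A :: "'a::comm_ring_1 ^ 'n::finite ^ 'n"
  assumes "UNIV = {i, j :: 'n}" "i \<noteq> j"
  shows "det A = A $ i $ i * A $ j $ j - A $ i $ j * A $ j $ i"
proof -
  have f: "finite {j}" "i \<notin> {j}" using assms by auto
  show ?thesis
    unfolding det_def assms(1)
    unfolding sum_over_permutations_insert[OF f]
    unfolding permutes_sing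
    using assms(2) by (simp add: sign_swap_id sign_id swap_id_eq)
qed

context join_coherent_semilinear
begin

section \<open>Two shears with a common hyperplane: dimension and scalars\<close>

lemma shear_in_G: "i \<noteq> j \<Longrightarrow> shear i j c \<in> G"
  using shear_in_SL SL_subset by blast

text \<open>The orbit of \<open>axis j 1\<close> under the join is an arithmetic progression with
  difference \<open>a\<close>. Both shears preserve it, so both displacements of
  \<open>axis j 1\<close> are integer multiples of \<open>a\<close>.\<close>

lemma shears_commensurable:
  assumes "i \<noteq> j" "i' \<noteq> j"
  obtains a :: "'a ^ 'n" and m n :: int
  where "axis i c = of_int m *s a" "axis i' c' = of_int n *s a"
proof -
  obtain g \<phi> where g: "g \<in> G" and \<phi>: "\<phi> \<in> \<Phi>"
    and join: "\<And>S. preserves (g \<circ> coordinatewise \<phi>) S \<longleftrightarrow>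
      preserves (shear i j c) S \<and> preserves (shear i' j c') S"
    using join_preserves[OF shear_in_G[OF assms(1), of c] shear_in_G[OF assms(2), of c']] by blast
  have aut: "\<phi> \<in> field_aut" using \<phi> Phi_aut by blast
  \<comment> \<open>Both shears fix each point of the hyperplane, so its singletons are invariant
    sets.\<close>
  have fix_hyperplane: "g (coordinatewise \<phi> v) = v" if "v $ j = 0" for v
  proof -
    have "preserves (shear l j b) {v}" if "l \<noteq> j" for b l
    proof -
      have "shear l j b w = v \<longleftrightarrow> w = v" for w
      proof -
        have "shear l j b w $ j = w $ j"
          using that by (simp add: shear_def axis_def)
        moreover have "shear l j b w = w" if "w $ j = 0"
          using that by (simp add: shear_def axis_def vec_eq_iff)
        ultimately show ?thesis using \<open>v $ j = 0\<close> by metis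
      qed
      then show ?thesis by (simp add: preserves_def)
    qed
    then have "preserves (g \<circ> coordinatewise \<phi>) {v}" using join assms by blast
    then show ?thesis by (simp add: preserves_def)
  qed
  \<comment> \<open>On the line through \<open>axis i 1\<close>, which lies in the hyperplane,
    \<open>g\<close> inverts the action of \<phi>. But \<open>g\<close> is linear and fixes
    \<open>axis i 1\<close>, hence is the identity on this line, and so is \<phi>.\<close>
  have \<phi>_id: "\<phi> = id"
  proof
    fix b :: 'a
    have c: "coordinatewise \<phi> (axis i x) = axis i (\<phi> x)" for x
      using field_aut_0[OF aut] by (simp add: vec_eq_iff coordinatewise_def axis_def)
    have g_fix: "g (axis i (\<phi> x)) = axis i x" for x
      using fix_hyperplane[of "axis i x"] assms c by (simp add: axis_def)
    have "axis i b = g (\<phi> b *s axis i (\<phi> 1))"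
      using g_fix[of b] field_aut_1[OF aut] by (simp add: axis_scale)
    also have "\<dots> = axis i (\<phi> b)"
      unfolding G_linear(4)[OF g] g_fix by (simp add: axis_scale)
    finally show "\<phi> b = id b" by (simp add: axis_eq_axis) (metis axis_nth)
  qed
  define a where "a = g (axis j 1) - axis j 1"
  have a_j: "a $ j = 0"
  proof -
    have "preserves (shear l j b) {w. w $ j = 1}" if "l \<noteq> j" for l and b :: 'a
      using that by (simp add: preserves_def shear_def axis_def)
    then have "preserves g {w. w $ j = 1}" using join assms \<phi>_id by simp
    then show ?thesis by (simp add: a_def preserves_def)
  qed
  \<comment> \<open>This is the full orbit of \<open>axis j 1\<close> under \<open>g\<close>:
    \<open>a\<close> lies in the fixed hyperplane, so each application of \<open>g\<close> adds
    \<open>a\<close> once more.\<close>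
  define S where "S = range (\<lambda>m. axis j 1 + of_int m *s a)"
  have shift: "g (axis j 1 + of_int m *s a) = axis j 1 + of_int (m + 1) *s a" for m
  proof -
    have "g a = a" using fix_hyperplane[OF a_j] \<phi>_id by simp
    then have "g (axis j 1 + of_int m *s a) = g (axis j 1) + of_int m *s a"
      by (simp add: G_linear[OF g])
    then show ?thesis by (simp add: a_def vec_eq_iff algebra_simps)
  qed
  have "g v \<in> S \<longleftrightarrow> v \<in> S" for v
  proof
    show "g v \<in> S" if v: "v \<in> S"
    proof -
      obtain m where "v = axis j 1 + of_int m *s a" using v unfolding S_def by blast
      then have "g v = axis j 1 + of_int (m + 1) *s a" using shift[of m] by (simp only:)
      then show ?thesis unfolding S_def by blast
    qed
    assume "g v \<in> S"
    then obtain m where "g v = axis j 1 + of_int m *s a" unfolding S_def by blast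
    then have "g v = g (axis j 1 + of_int (m - 1) *s a)" using shift[of "m - 1"] by simp
    then have "v = axis j 1 + of_int (m - 1) *s a"
      using G_linear(2)[OF g] by (simp add: bij_def inj_eq)
    then show "v \<in> S" unfolding S_def by blast
  qed
  then have "preserves (shear i j c) S" "preserves (shear i' j c') S"
    using join[of S] by (simp_all add: \<phi>_id preserves_def)
  moreover have "axis j 1 \<in> S" unfolding S_def by (rule range_eqI[of _ _ 0]) simp
  ultimately have "shear i j c (axis j 1) \<in> S" "shear i' j c' (axis j 1) \<in> S"
    by (simp_all add: preserves_def)
  then obtain m n where "shear i j c (axis j 1) = axis j 1 + of_int m *s a"
    "shear i' j c' (axis j 1) = axis j 1 + of_int n *s a"
    unfolding S_def by blast
  then show thesis using that[of m a n] by (simp add: shear_def)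
qed

text \<open>With a third index, shears in two independent directions share a hyperplane, and two
  distinct basis vectors would be multiples of one vector.\<close>

lemma card_le_2: "CARD('n) \<le> 2"
proof (rule ccontr)
  assume "\<not> CARD('n) \<le> 2"
  then have "3 \<le> CARD('n)" by simp
  then obtain T :: "'n set" where "card T = 3" using obtain_subset_with_card_n by blast
  then obtain i j k :: 'n where ne: "i \<noteq> j" "i \<noteq> k" "j \<noteq> k" by (auto simp: card_3_iff)
  obtain a :: "'a ^ 'n" and m n where a: "axis i 1 = of_int m *s a" "axis k 1 = of_int n *s a"
    using shears_commensurable[of i j k 1 1] ne by blast
  have "1 = of_int m * a $ i" "0 = of_int m * a $ k" "1 = of_int n * a $ k"
    using arg_cong[OF a(1), of "\<lambda>v. v $ i"] arg_cong[OF a(1), of "\<lambda>v. v $ k"]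
      arg_cong[OF a(2), of "\<lambda>v. v $ k"] ne by (simp_all add: axis_def)
  then show False by (metis mult_eq_0_iff zero_neq_one)
qed

text \<open>The two shears are taken in the same direction, with coefficients 1 and
  \<open>x\<close>.\<close>

lemma ratio_of_ints:
  fixes x :: 'a and i j :: 'n
  assumes "i \<noteq> j"
  obtains m n :: int where "of_int n \<noteq> (0 :: 'a)" "x * of_int n = of_int m"
proof -
  obtain a :: "'a ^ 'n" and m n where a: "axis i 1 = of_int n *s a" "axis i x = of_int m *s a"
    using shears_commensurable[of i j i 1 x] assms by blast
  have *: "1 = of_int n * a $ i" "x = of_int m * a $ i"
    using arg_cong[OF a(1), of "\<lambda>v. v $ i"] arg_cong[OF a(2), of "\<lambda>v. v $ i"]
    by (simp_all add: axis_def)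
  then have "of_int n \<noteq> (0 :: 'a)" by auto
  moreover have "x * of_int n = of_int m" using * by (metis mult.assoc mult.commute mult_1)
  ultimately show thesis by (rule that)
qed

text \<open>Automorphisms fix the images of integers, hence their quotients, which are all scalars.
  The earlier argument gave triviality only for the automorphism occurring in one particular
  join.\<close>

lemma Phi_trivial:
  assumes "i \<noteq> (j :: 'n)" "\<phi> \<in> \<Phi>" shows "\<phi> = id"
proof
  fix x :: 'a
  obtain m n :: int where mn: "of_int n \<noteq> (0 :: 'a)" "x * of_int n = of_int m"
    using ratio_of_ints[OF assms(1), of x] by blast
  have aut: "\<phi> \<in> field_aut" using assms Phi_aut by blast
  then have "\<phi> (x * of_int n) = \<phi> x * \<phi> (of_int n)" by (simp add: field_aut_def)
  then show "\<phi> x = id x" using mn field_aut_of_int[OF aut] by (metis id_apply mult_right_cancel)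
qed

section \<open>Two dilations: reduction to determinant 1\<close>

lemma join_preserves_linear:
  assumes "i \<noteq> (j :: 'n)" and h: "h \<in> G" and k: "k \<in> G"
  obtains g where "g \<in> G" "\<And>S. preserves g S \<longleftrightarrow> preserves h S \<and> preserves k S"
proof -
  obtain g \<phi> where g: "g \<in> G" "\<phi> \<in> \<Phi>"
    and join: "\<And>S. preserves (g \<circ> coordinatewise \<phi>) S \<longleftrightarrow> preserves h S \<and> preserves k S"
    using join_preserves[OF h k] by blast
  have "\<phi> = id" by (rule Phi_trivial[OF assms(1) g(2)])
  then show thesis using that[OF g(1)] join by simp
qed

text \<open>The dilation composed with the inverse of \<open>g\<close> has determinant 1, so it lies
  in \<open>SL\<close> and hence in \<open>G\<close>; composing with \<open>g\<close> gives back the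
  dilation.\<close>

lemma dilation_det_in_G:
  assumes g: "g \<in> G" shows "dilation i (det (matrix g)) \<in> G"
proof -
  let ?a = "det (matrix g)"
  note G = G_subgroup[unfolded subgroup_BijGroup_UNIV_iff]
  have inv: "inv_into UNIV g \<in> G" using G g by blast
  have "g \<circ> inv_into UNIV g = id" using G_linear(2)[OF g] by (simp add: bij_is_surj flip: surj_iff)
  then have "matrix g ** matrix (inv_into UNIV g) = mat 1"
    using matrix_compose_gen[OF G_linear(1)[OF inv] G_linear(1)[OF g]] by (simp add: matrix_id_mat_1)
  then have det: "?a * det (matrix (inv_into UNIV g)) = 1"
    by (metis det_I det_mul)
  then have "?a \<noteq> 0" by auto
  then have D: "dilation i ?a \<in> (GL :: ('a ^ 'n \<Rightarrow> 'a ^ 'n) set)" by (rule dilation_in_GL(1))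
  let ?s = "dilation i ?a \<circ> inv_into UNIV g"
  have lin: "Vector_Spaces.linear (*s) (*s) (dilation i ?a :: 'a ^ 'n \<Rightarrow> 'a ^ 'n)"
    and bij: "bij (dilation i ?a :: 'a ^ 'n \<Rightarrow> 'a ^ 'n)"
    using D by (auto simp: GL_def)
  have "?s \<in> GL"
    using Vector_Spaces.linear_compose[OF G_linear(1)[OF inv] lin]
      bij_comp[OF G_linear(2)[OF inv] bij] by (simp add: GL_def)
  moreover have "det (matrix ?s) = 1"
    unfolding matrix_compose_gen[OF G_linear(1)[OF inv] lin] det_mul dilation_in_GL(2) by (rule det)
  ultimately have "?s \<circ> g \<in> G" using SL_subset G g by (auto simp: SL_def)
  moreover have "inv_into UNIV g \<circ> g = id" using G_linear(2)[OF g] by (simp add: bij_is_inj)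
  ultimately show ?thesis by (simp add: comp_assoc)
qed

lemma dilation_trivial:
  fixes a :: 'a and i j :: 'n
  assumes ij: "i \<noteq> j" and "a \<noteq> 0" and Gi: "dilation i a \<in> G" and Gj: "dilation j a \<in> G"
  shows "a = 1"
proof -
  obtain g where g: "g \<in> G"
    and join: "\<And>S. preserves g S \<longleftrightarrow> preserves (dilation i a) S \<and> preserves (dilation j a) S"
    using join_preserves_linear[OF ij Gi Gj] by blast
  have inj: "g v = g w \<longleftrightarrow> v = w" for v w
    using G_linear(2)[OF g] by (simp add: bij_def inj_eq)
  \<comment> \<open>Dilations preserve every coordinate axis, hence so does
    \<open>g\<close>.\<close>
  have line: "\<exists>x. g (axis l 1) = axis l x" for l
  proof -
    let ?S = "{v :: 'a ^ 'n. \<forall>k. k \<noteq> l \<longrightarrow> v $ k = 0}"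
    have "dilation m a v $ k = 0 \<longleftrightarrow> v $ k = 0" for m k and v :: "'a ^ 'n"
      using \<open>a \<noteq> 0\<close> by (simp add: dilation_def)
    then have "preserves g ?S" unfolding join by (simp add: preserves_def)
    then have "g (axis l 1) \<in> ?S" by (simp add: preserves_def axis_def)
    then have "g (axis l 1) = axis l (g (axis l 1) $ l)" by (simp add: vec_eq_iff axis_def)
    then show ?thesis by blast
  qed
  obtain x y where x: "g (axis i 1) = axis i x" and y: "g (axis j 1) = axis j y"
    using line by metis
  have g_axes: "g (axis i b + axis j c) = axis i (x * b) + axis j (y * c)" for b c
  proof -
    have "g (b *s axis i 1 + c *s axis j 1) = b *s axis i x + c *s axis j y"
      unfolding G_linear[OF g] x y ..
    then show ?thesis by (simp add: axis_scale mult.commute)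
  qed
  have "x \<noteq> 0" "y \<noteq> 0"
    using inj[of "axis i 1" 0] inj[of "axis j 1" 0] x y G_linear(5)[OF g] by (auto simp: axis_eq_0_iff)
  \<comment> \<open>The vectors on axis \<open>j\<close> whose coordinate is a power of
    \<open>a\<close> form a set invariant under both dilations. It contains \<open>axis j 1\<close>,
    hence also its image under \<open>g\<close>.\<close>
  obtain e :: int where e: "y = a powi e"
  proof -
    let ?S = "{v :: 'a ^ 'n. (\<forall>k. k \<noteq> j \<longrightarrow> v $ k = 0) \<and> v $ j \<in> range (\<lambda>e :: int. a powi e)}"
    have "a * c \<in> range (\<lambda>e :: int. a powi e) \<longleftrightarrow> c \<in> range (\<lambda>e :: int. a powi e)" for c
    proof
      assume "a * c \<in> range (\<lambda>e :: int. a powi e)"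
      then obtain e :: int where "a * c = a powi e" by blast
      then have "c = a powi (e - 1)" using \<open>a \<noteq> 0\<close> by (simp add: power_int_diff field_simps)
      then show "c \<in> range (\<lambda>e :: int. a powi e)" by blast
    next
      assume "c \<in> range (\<lambda>e :: int. a powi e)"
      then obtain e :: int where "c = a powi e" by blast
      then have "a * c = a powi (1 + e)" using \<open>a \<noteq> 0\<close> by (simp add: power_int_add)
      then show "a * c \<in> range (\<lambda>e :: int. a powi e)" by blast
    qed
    then have "preserves g ?S"
      unfolding join using \<open>a \<noteq> 0\<close> ij by (auto simp: preserves_def dilation_def)
    moreover have "1 \<in> range (\<lambda>e :: int. a powi e)" by (rule range_eqI[of _ _ 0]) simp
    then have "axis j 1 \<in> ?S" by (simp add: axis_def)
    ultimately have "axis j y \<in> ?S" unfolding preserves_def y[symmetric] by blast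
    then have "y \<in> range (\<lambda>e :: int. a powi e)" by simp
    then show thesis using that by blast
  qed
  \<comment> \<open>The range of \<open>?f\<close> is the orbit of
    \<open>axis i 1 + axis j 1\<close> under \<open>g\<close>; integer exponents are needed to
    include the inverse of \<open>g\<close>.\<close>
  let ?f = "\<lambda>k :: int. axis i (x powi k) + axis j (y powi k) :: 'a ^ 'n"
  have shift: "g (?f k) = ?f (1 + k)" for k
    using \<open>x \<noteq> 0\<close> \<open>y \<noteq> 0\<close> by (simp add: g_axes power_int_add)
  have "g v \<in> range ?f \<longleftrightarrow> v \<in> range ?f" for v
  proof
    assume "g v \<in> range ?f"
    then obtain k where "g v = ?f k" by blast
    then have "g v = g (?f (k - 1))" using shift[of "k - 1"] by simp
    then have "v = ?f (k - 1)" unfolding inj .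
    then show "v \<in> range ?f" by blast
  next
    assume "v \<in> range ?f"
    then obtain k where "v = ?f k" by blast
    then have "g v = ?f (1 + k)" using shift by (simp only:)
    then show "g v \<in> range ?f" by blast
  qed
  then have "preserves (dilation i a) (range ?f)" "preserves (dilation j a) (range ?f)"
    using join[of "range ?f"] by (simp_all add: preserves_def)
  moreover have "axis i 1 + axis j 1 \<in> range ?f" by (rule range_eqI[of _ _ 0]) simp
  ultimately have "dilation i a (axis i 1 + axis j 1) \<in> range ?f"
    "dilation j a (axis i 1 + axis j 1) \<in> range ?f"
    by (simp_all add: preserves_def)
  then obtain k l where k: "dilation i a (axis i 1 + axis j 1) = ?f k"
    and l: "dilation j a (axis i 1 + axis j 1) = ?f l" by blast
  have "x powi k = a" "x powi l = 1" "y powi l = a"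
    using arg_cong[OF k, of "\<lambda>v. v $ i"] arg_cong[OF l, of "\<lambda>v. v $ i"]
      arg_cong[OF l, of "\<lambda>v. v $ j"] ij by (simp_all add: dilation_def axis_def)
  \<comment> \<open>From \<open>y powi l = a\<close>, substitute \<open>y = a powi e\<close> and
    then \<open>a = x powi k\<close>; regrouping the exponents brings out \<open>x powi l\<close>,
    which is 1.\<close>
  then have "a = ((x powi k) powi e) powi l" using e by simp
  also have "\<dots> = (x powi l) powi (k * e)"
    by (simp add: mult.commute mult.left_commute flip: power_int_mult)
  finally show "a = 1" using \<open>x powi l = 1\<close> by simp
qed

lemma det_eq_1:
  assumes "i \<noteq> (j :: 'n)" "g \<in> G" shows "det (matrix g) = 1"
proof -
  have "bij g" "Vector_Spaces.linear (*s) (*s) g" using G_linear assms by blast+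
  then have "det (matrix g) \<noteq> 0"
    using det_nz_iff_inj_gen[of g] by (simp add: bij_is_inj)
  then show ?thesis using dilation_trivial[OF assms(1)] dilation_det_in_G[OF assms(2)] by blast
qed

section \<open>An upper and a lower shear: characteristic 2\<close>

lemma two_eq_0:
  assumes UNIV: "UNIV = {i, j :: 'n}" and ij: "i \<noteq> j"
  shows "(2 :: 'a) = 0"
proof (rule ccontr)
  assume two: "(2 :: 'a) \<noteq> 0"
  let ?h = "shear i j (1 :: 'a)" and ?k = "shear j i (1 :: 'a)"
  obtain g where g: "g \<in> G"
    and join: "\<And>S. preserves g S \<longleftrightarrow> preserves ?h S \<and> preserves ?k S"
    using join_preserves_linear[OF ij shear_in_G[OF ij] shear_in_G[OF ij[symmetric]]] by blast
  define p q s t where pqst: "p = g (axis i 1) $ i" "q = g (axis i 1) $ j"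
    "s = g (axis j 1) $ i" "t = g (axis j 1) $ j"
  have expand: "v = v $ i *s axis i 1 + v $ j *s axis j 1" for v :: "'a ^ 'n"
  proof (subst vec_eq_iff, intro allI)
    fix k
    have "k = i \<or> k = j" using UNIV by blast
    then show "v $ k = (v $ i *s axis i 1 + v $ j *s axis j 1) $ k" using ij by (auto simp: axis_def)
  qed
  have g_expand: "g v = v $ i *s g (axis i 1) + v $ j *s g (axis j 1)" for v
    using arg_cong[OF expand[of v], of g] by (simp only: G_linear[OF g])
  have g_i: "g v $ i = p * v $ i + s * v $ j" and g_j: "g v $ j = q * v $ i + t * v $ j" for v
    using arg_cong[OF g_expand[of v], of "\<lambda>w. w $ i"] arg_cong[OF g_expand[of v], of "\<lambda>w. w $ j"]
    by (simp_all add: pqst mult.commute)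
  have "det (matrix g) = p * t - s * q"
    by (simp add: det_UNIV_doubleton[OF UNIV ij] matrix_def pqst)
  then have det: "p * t - s * q = 1" using det_eq_1[OF ij g] by simp
  \<comment> \<open>This is the determinant of the pair \<open>v\<close>, \<open>g v\<close>.
    Applying \<open>g\<close> to both vectors multiplies it by the determinant of \<open>g\<close>,
    which is 1.\<close>
  define Q where "Q v = v $ i * g v $ j - v $ j * g v $ i" for v
  have "Q (g v) = (p * t - s * q) * Q v" for v
    unfolding Q_def g_i g_j by algebra
  then have Q_g: "Q (g v) = Q v" for v using det by simp
  have Q_shear: "Q (?h v) = Q v" "Q (?k v) = Q v" for v
  proof -
    \<comment> \<open>Level sets turn an invariant function into invariant sets.\<close>
    have "preserves g {w. Q w = Q v}" by (simp add: preserves_def Q_g)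
    then have "preserves ?h {w. Q w = Q v}" "preserves ?k {w. Q w = Q v}" using join by blast+
    then show "Q (?h v) = Q v" "Q (?k v) = Q v" by (simp_all add: preserves_def)
  qed
  \<comment> \<open>The upper shear takes \<open>axis j 1\<close> to
    \<open>axis i 1 + axis j 1\<close>, and the latter to \<open>2 *s axis i 1 + axis j 1\<close>.
    Equating the values of \<open>Q\<close> gives two equations whose difference is
    \<open>2 * q = 0\<close>.\<close>
  have "q + t - p = 0"
    using Q_shear(1)[of "axis j 1"] ij
    by (simp add: Q_def g_i g_j shear_def axis_def algebra_simps)
  moreover have "3 * q + t - p = 0"
    using Q_shear(1)[of "axis i 1 + axis j 1"] ij
    by (simp add: Q_def g_i g_j shear_def axis_def algebra_simps)
  ultimately have "2 * q = 0" by algebra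
  then have q: "q = 0" using two by simp
  then have "t \<noteq> 0" using det by auto
  \<comment> \<open>With \<open>q = 0\<close> the map \<open>g\<close> is upper triangular and keeps
    this line, whereas the lower shear moves \<open>axis i 1\<close> off it.\<close>
  have "preserves g {v. v $ j = 0}" using q \<open>t \<noteq> 0\<close> by (simp add: preserves_def g_j)
  then have "preserves ?k {v. v $ j = 0}" using join by blast
  then have "?k (axis i 1) \<in> {v. v $ j = 0} \<longleftrightarrow> axis i 1 \<in> {v :: 'a ^ 'n. v $ j = 0}"
    unfolding preserves_def by blast
  then show False using ij by (simp add: shear_def axis_def)
qed

text \<open>In characteristic 2 the image of an integer is 0 or 1, so a nonzero denominator is 1 and
  every scalar is itself 0 or 1.\<close>

lemma card_field:
  assumes "UNIV = {i, j :: 'n}" "i \<noteq> j" shows "CARD('a) = 2"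
proof -
  have two: "(2 :: 'a) = 0" by (rule two_eq_0[OF assms])
  have int: "(of_int m :: 'a) \<in> {0, 1}" for m
  proof -
    have "(of_int m :: 'a) = of_int (2 * (m div 2) + m mod 2)" by simp
    also have "\<dots> = of_int (m mod 2)" by (simp only: of_int_add of_int_mult) (simp add: two)
    finally show ?thesis using pos_mod_bound[of 2 m] pos_mod_sign[of 2 m]
      by (cases "m mod 2 = 0") (auto simp: not_mod_2_eq_0_eq_1)
  qed
  have "x \<in> {0, 1}" for x :: 'a
    using ratio_of_ints[OF assms(2), of x] int by (metis insertE insertI1 insertI2 mult.right_neutral singletonD)
  then have "(UNIV :: 'a set) = {0, 1}" by blast
  then have "CARD('a) = card {0, 1 :: 'a}" by (rule arg_cong)
  then show ?thesis by simp
qed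

end

text \<open>\<open>CARD('a) = 2\<close> expresses that the field is F_2: a field with two elements
  is unique up to isomorphism, and infinite types have \<open>CARD\<close> equal to 0.\<close>

theorem proposition8p7:
  fixes G :: "('a::field ^ 'n \<Rightarrow> 'a ^ 'n) set"
    and \<Phi> :: "('a \<Rightarrow> 'a) set"
  assumes "CARD('n) > 1"
    and "subgroup \<Phi> (BijGroup UNIV)" and "\<Phi> \<subseteq> field_aut"
    and "subgroup G (BijGroup UNIV)" and "SL \<subseteq> G" and "G \<subseteq> GL"
    and "normalizes \<Phi> G"
    and "join_coherent (semilinear_group G \<Phi>) (UNIV - {0}) nonzero_action"
  shows "CARD('a) = 2 \<and> CARD('n) = 2"
proof -
  interpret join_coherent_semilinear G \<Phi>
    using assms(2-8) by (rule join_coherent_semilinear.intro)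
  have card: "CARD('n) = 2" using assms(1) card_le_2 by simp
  then obtain i j :: 'n where "UNIV = {i, j}" "i \<noteq> j" by (auto simp: card_2_iff)
  then show ?thesis using card card_field[of i j] by simp
qed

end
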